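(* Let $G$ be a connected graph of order $n\ge 2$, and let $\mathcal{H}=\{H_1,\dots,H_n\}$ be a family of $n$ connected non-trivial graphs, where $V_i$ denotes the vertex set of $H_i$. Then, for every $i\in\{1,\dots,n\}$, every vertex of $H_i$ is a twin in $H_i$, if and only if $$\dim_2(G\odot\mathcal{H})=\sum_{i=1}^{n}|V_i|.$$
   Context: All graphs are finite, simple and undirected; a graph is non-trivial if it has at least two vertices. Two different vertices $x,y$ of a graph are twins if $N(x)=N(y)$ (false twins) or $N[x]=N[y]$ (true twins), where $N(x)$ and $N[x]=N(x)\cup\{x\}$ are the open and closed neighborhoods. A vertex $x$ is a twin if there is another vertex $y$ such that $x,y$ are twins. For a connected graph $\Gamma$, $d_\Gamma(x,y)$ is the length of a shortest path between $x$ and $y$. A set $S\subseteq V(\Gamma)$ is a $2$-metric generator for $\Gamma$ if for any two different vertices $u,v$ of $\Gamma$ there are at least two vertices $w\in S$ with $d_\Gamma(u,w)\neq d_\Gamma(v,w)$. The minimum cardinality of a $2$-metric generator is $\dim_2(\Gamma)$ (it always exists for graphs of order at least $2$). Corona product: if $G$ has vertices $v_1,\dots,v_n$ and $\mathcal{H}=\{H_1,\dots,H_n\}$ is a family of $n$ graphs (repetitions up to isomorphism allowed), $G\odot\mathcal{H}$ is obtained from the disjoint union of $G$ and $H_1,\dots,H_n$ by joining, for each $i$, the vertex $v_i$ by an edge to every vertex of $H_i$. *)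

theory Defs
  imports Graph_Theory.Digraph_Component Graph_Theory.Shortest_Path
begin

text \<open>
  A finite simple undirected graph is a \<^locale>\<open>pair_graph\<close>: a finite, loop-free, symmetric
  digraph whose arcs are pairs of vertices, an undirected edge being a pair of opposite arcs.
\<close>

definition open_nbhd :: "'a pair_pre_digraph \<Rightarrow> 'a \<Rightarrow> 'a set" where
  "open_nbhd G x = {y. (x, y) \<in> parcs G}"

definition closed_nbhd :: "'a pair_pre_digraph \<Rightarrow> 'a \<Rightarrow> 'a set" where
  "closed_nbhd G x = insert x (open_nbhd G x)"

definition twins :: "'a pair_pre_digraph \<Rightarrow> 'a \<Rightarrow> 'a \<Rightarrow> bool" where
  "twins G x y \<longleftrightarrow> x \<in> pverts G \<and> y \<in> pverts G \<and> x \<noteq> y \<and>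
     (open_nbhd G x = open_nbhd G y \<or> closed_nbhd G x = closed_nbhd G y)"

definition is_twin :: "'a pair_pre_digraph \<Rightarrow> 'a \<Rightarrow> bool" where
  "is_twin G x \<longleftrightarrow> (\<exists>y. twins G x y)"

text \<open>Meaningful only if some path from \<open>u\<close> to \<open>v\<close> exists, e.g. if \<open>G\<close> is connected.\<close>

definition graph_dist :: "'a pair_pre_digraph \<Rightarrow> 'a \<Rightarrow> 'a \<Rightarrow> nat" where
  "graph_dist G u v = (LEAST k. \<exists>p. pre_digraph.apath G u p v \<and> length p = k)"

definition two_metric_generator :: "'a pair_pre_digraph \<Rightarrow> 'a set \<Rightarrow> bool" where
  "two_metric_generator G S \<longleftrightarrow> S \<subseteq> pverts G \<and>
     (\<forall>u\<in>pverts G. \<forall>v\<in>pverts G. u \<noteq> v \<longrightarrow>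
        2 \<le> card {w \<in> S. graph_dist G u w \<noteq> graph_dist G v w})"

definition two_metric_dim :: "'a pair_pre_digraph \<Rightarrow> nat" where
  "two_metric_dim G = (LEAST k. \<exists>S. two_metric_generator G S \<and> card S = k)"

text \<open>
  The family is indexed by the vertices of \<open>G\<close>. The vertex \<open>v\<close> of \<open>G\<close> becomes \<open>Inl v\<close>,
  and the vertex \<open>x\<close> of \<open>H v\<close> becomes \<open>Inr (v, x)\<close>, so that the copies are disjoint
  even if the vertex sets of the graphs in the family are not.
\<close>

definition corona ::
  "'a pair_pre_digraph \<Rightarrow> ('a \<Rightarrow> 'b pair_pre_digraph) \<Rightarrow> ('a + 'a \<times> 'b) pair_pre_digraph" where
  "corona G H = \<lparr>
     pverts = Inl ` pverts G \<union> Inr ` (SIGMA v:pverts G. pverts (H v)),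
     parcs = {(Inl u, Inl v) | u v. (u, v) \<in> parcs G}
       \<union> {(Inr (v, x), Inr (v, y)) | v x y. v \<in> pverts G \<and> (x, y) \<in> parcs (H v)}
       \<union> {(Inl v, Inr (v, x)) | v x. v \<in> pverts G \<and> x \<in> pverts (H v)}
       \<union> {(Inr (v, x), Inl v) | v x. v \<in> pverts G \<and> x \<in> pverts (H v)} \<rparr>"

subsection \<open>Well-definedness\<close>

text \<open>On reachable pairs the distance is the library's shortest-path weight for unit weights.\<close>

lemma graph_dist_eq_unit_weight:
  assumes "pair_wf_digraph G" and "u \<rightarrow>\<^sup>*\<^bsub>with_proj G\<^esub> v"
  shows "wf_digraph.\<mu> G (\<lambda>_. 1) u v = ereal (real (graph_dist G u v))"
proof -
  interpret pair_wf_digraph G by fact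
  have cost: "awalk_cost (\<lambda>_. 1) p = real (length p)" for p :: "('a \<times> 'a) awalk"
    by (induction p) auto
  let ?P = "\<lambda>k. \<exists>p. apath u p v \<and> length p = k"
  have "\<exists>p. apath u p v"
    using assms(2) by (simp add: reachable_apath)
  then have "\<exists>k. ?P k" by blast
  then obtain q where q: "apath u q v" "length q = graph_dist G u v"
    unfolding graph_dist_def using LeastI_ex[of ?P] by blast
  have "graph_dist G u v \<le> length p" if "awalk u p v" for p
  proof -
    have "?P (length (awalk_to_apath p))"
      using apath_awalk_to_apath[OF that] by blast
    then have "graph_dist G u v \<le> length (awalk_to_apath p)"
      unfolding graph_dist_def by (rule Least_le)
    also have "\<dots> \<le> length p"
      using awalk_to_path_no_neg_cyc_cost[OF that, of "\<lambda>_. 1"] by (simp add: cost)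
    finally show ?thesis .
  qed
  then show ?thesis
    unfolding \<mu>_def cost using q awalkI_apath[OF q(1)]
    by (intro antisym INF_greatest) (auto intro!: INF_lower2[of q])
qed

lemma graph_dist_self:
  assumes "pair_wf_digraph G" and "u \<in> pverts G"
  shows "graph_dist G u u = 0"
proof -
  interpret pair_wf_digraph G by fact
  show ?thesis unfolding graph_dist_def
    using assms(2) by (intro Least_eq_0) (simp add: apath_Nil_iff)
qed

lemma connected_reachable:
  assumes "pair_graph G" and "Digraph_Component.connected G" and "u \<in> pverts G" and "v \<in> pverts G"
  shows "u \<rightarrow>\<^sup>*\<^bsub>with_proj G\<^esub> v"
proof -
  interpret pair_graph G by fact
  show ?thesis
    using symmetric_connected_imp_strongly_connected[OF sym_arcs assms(2)] assms(3,4)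
    by (auto simp: strongly_connected_def)
qed

lemma graph_dist_neq_0:
  assumes "pair_graph G" and "Digraph_Component.connected G"
    and "u \<in> pverts G" and "v \<in> pverts G" and "u \<noteq> v"
  shows "graph_dist G u v \<noteq> 0"
proof
  interpret pair_graph G by fact
  let ?P = "\<lambda>k. \<exists>p. apath u p v \<and> length p = k"
  assume "graph_dist G u v = 0"
  moreover have "\<exists>k. ?P k"
    using connected_reachable[OF assms(1-4)] reachable_apath by blast
  ultimately have "?P 0"
    unfolding graph_dist_def using LeastI_ex[of ?P] by simp
  then show False using assms(5) by (auto simp: apath_Nil_iff)
qed

lemma two_metric_generator_pverts:
  assumes "pair_graph G" and "Digraph_Component.connected G"
  shows "two_metric_generator G (pverts G)"
  unfolding two_metric_generator_def
proof (intro conjI ballI impI)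
  interpret pair_graph G by fact
  fix u v assume uv: "u \<in> pverts G" "v \<in> pverts G" "u \<noteq> v"
  have "{u, v} \<subseteq> {w \<in> pverts G. graph_dist G u w \<noteq> graph_dist G v w}"
    using uv graph_dist_self[of G] graph_dist_neq_0[OF assms] pair_wf_digraph by auto
  from card_mono[OF _ this] uv(3) pair_finite_verts
  show "2 \<le> card {w \<in> pverts G. graph_dist G u w \<noteq> graph_dist G v w}" by simp
qed simp

lemma pair_graph_corona:
  assumes "pair_graph G" and "\<And>v. v \<in> pverts G \<Longrightarrow> pair_graph (H v)"
  shows "pair_graph (corona G H)"
proof -
  interpret G: pair_graph G by fact
  have wf: "x \<in> pverts (H v)" "y \<in> pverts (H v)" "x \<noteq> y" "(y, x) \<in> parcs (H v)"
    if "v \<in> pverts G" "(x, y) \<in> parcs (H v)" for v x y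
  proof -
    interpret H: pair_graph "H v" using assms(2) that(1) .
    show "x \<in> pverts (H v)" "y \<in> pverts (H v)" "x \<noteq> y" "(y, x) \<in> parcs (H v)"
      using that(2) H.in_arcsD1 H.in_arcsD2 H.pair_no_loops H.arcs_symmetric by fastforce+
  qed
  have Gwf: "x \<in> pverts G" "y \<in> pverts G" "x \<noteq> y" "(y, x) \<in> parcs G"
    if "(x, y) \<in> parcs G" for x y
    using that G.in_arcsD1 G.in_arcsD2 G.pair_no_loops G.arcs_symmetric by fastforce+
  have finH: "finite (pverts (H v))" if "v \<in> pverts G" for v
    using assms(2)[OF that] pair_fin_digraph.pair_finite_verts
    by (metis pair_digraph_def pair_graph_def)
  let ?C = "corona G H"
  have fin: "finite (pverts ?C)"
    using G.pair_finite_verts finH by (auto simp: corona_def)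
  have sub: "parcs ?C \<subseteq> pverts ?C \<times> pverts ?C"
    by (auto simp: corona_def Gwf(1-2) wf(1-2))
  show ?thesis
  proof
    show "finite (parcs ?C)" using fin sub finite_subset by blast
    show "symmetric ?C"
      by (auto simp: symmetric_def sym_def corona_def intro: Gwf(4) wf(4))
    show "fst e \<noteq> snd e" if "e \<in> parcs ?C" for e
      using that by (auto simp: corona_def dest: Gwf(3) wf(3))
  qed (use fin sub in auto)
qed

text \<open>Hence all distances in a corona product are lengths of existing paths.\<close>

lemma connected_corona:
  assumes "pair_graph G" and "Digraph_Component.connected G"
    and "\<And>v. v \<in> pverts G \<Longrightarrow> pair_graph (H v)"
  shows "Digraph_Component.connected (corona G H)"
proof -
  interpret G: pair_graph G by fact
  let ?C = "corona G H"
  interpret C: pair_graph ?C using pair_graph_corona[OF assms(1,3)] .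
  have arc: "x \<rightarrow>\<^sup>*\<^bsub>with_proj ?C\<^esub> y" if "(x, y) \<in> parcs ?C" for x y
    using that by (intro C.adj_in_verts C.reachable_adjI) simp
  have lift: "Inl u \<rightarrow>\<^sup>*\<^bsub>with_proj ?C\<^esub> (Inl v :: 'a + 'a \<times> 'b)" if "u \<rightarrow>\<^sup>*\<^bsub>with_proj G\<^esub> v" for u v
    using that
  proof (induction rule: G.reachable_induct)
    case base
    then show ?case by (intro C.reachable_refl) (simp add: corona_def)
  next
    case (step x y)
    then have "Inl x \<rightarrow>\<^sup>*\<^bsub>with_proj ?C\<^esub> (Inl y :: 'a + 'a \<times> 'b)"
      by (intro arc) (simp add: corona_def)
    with step show ?case by (blast intro: C.reachable_trans)
  qed
  define base where "base = (\<lambda>z :: 'a + 'a \<times> 'b. case z of Inl v \<Rightarrow> v | Inr (v, _) \<Rightarrow> v)"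
  have base: "base z \<in> pverts G" "z \<rightarrow>\<^sup>*\<^bsub>with_proj ?C\<^esub> Inl (base z)" "Inl (base z) \<rightarrow>\<^sup>*\<^bsub>with_proj ?C\<^esub> z"
    if z: "z \<in> pverts ?C" for z
  proof -
    show "base z \<in> pverts G" using z by (auto simp: corona_def base_def)
    have "z = Inl (base z) \<or> ((z, Inl (base z)) \<in> parcs ?C \<and> (Inl (base z), z) \<in> parcs ?C)"
      using z by (auto simp: corona_def base_def)
    then show "z \<rightarrow>\<^sup>*\<^bsub>with_proj ?C\<^esub> Inl (base z)" "Inl (base z) \<rightarrow>\<^sup>*\<^bsub>with_proj ?C\<^esub> z"
      using arc C.reachable_refl[OF z] by auto
  qed
  have "strongly_connected ?C"
  proof (rule strongly_connectedI)
    obtain v where "v \<in> pverts G"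
      using assms(2) by (auto simp: connected_def strongly_connected_def mk_symmetric_def)
    then have "Inl v \<in> pverts ?C" by (simp add: corona_def)
    then show "verts ?C \<noteq> {}" by auto
    fix y z assume "y \<in> verts ?C" "z \<in> verts ?C"
    then show "y \<rightarrow>\<^sup>*\<^bsub>with_proj ?C\<^esub> z"
      using base[of y] base[of z] lift[OF connected_reachable[OF assms(1,2)]]
      by (metis C.reachable_trans with_proj_simps(1))
  qed
  then show ?thesis
    using C.reachable_mk_symmetric_eq[OF C.sym_arcs]
    by (simp add: connected_def strongly_connected_def)
qed

end

theory Submission
  imports Defs
begin

text \<open>
  Write \<open>U\<close> for the set of all vertices of the copies of the graphs \<open>H v\<close> (\<open>copies\<close> below), so that
  \<open>card U\<close> is the sum in the theorem, and call the copy of \<open>H v\<close> the fibre over \<open>v\<close>.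

  A fibre touches the rest of the corona only through its root \<open>v\<close>. Hence every vertex of the fibre
  is exactly one step further than \<open>v\<close> from everything outside (\<open>dist_leaving_fibre\<close>), while inside
  the fibre the root makes a path of length 2 available, so that distances record only equality and
  adjacency in \<open>H v\<close> (\<open>dist_within_fibre\<close>). In particular two vertices of one fibre can be
  distinguished only from within that fibre, and two vertices that are not in one fibre are
  distinguished by all vertices of a suitable fibre. So a set is a 2-metric generator as soon
  as it distinguishes twice the pairs within each fibre (\<open>two_metric_generator_if_fibrewise\<close>).

  Two vertices of a fibre are both in \<open>U\<close> and distinguish themselves from each other, hence \<open>U\<close> is a
  generator and the dimension is at most \<open>card U\<close>. Twins of \<open>H v\<close> are distinguished by no third
  vertex, hence both belong to every generator (\<open>twins_in_generator\<close>). If all vertices are twins,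
  every generator therefore contains \<open>U\<close>. Conversely, a vertex \<open>x\<close> that is not a twin is
  distinguished from each other vertex \<open>y\<close> of its fibre by \<open>y\<close> and by a third vertex. Then \<open>x\<close> can be
  removed from \<open>U\<close> (\<open>generator_copies_minus_nontwin\<close>), and the dimension is smaller than \<open>card U\<close>.
\<close>

section \<open>Distances and walks\<close>

lemma (in pair_wf_digraph) graph_dist_le_awalk:
  assumes "awalk u p v"
  shows "graph_dist G u v \<le> length p"
proof -
  have cost: "awalk_cost (\<lambda>_. 1) q = real (length q)" for q :: "('a \<times> 'a) awalk"
    by (induction q) auto
  have "ereal (real (graph_dist G u v)) = \<mu> (\<lambda>_. 1) u v"
    using graph_dist_eq_unit_weight[OF pair_wf_digraph_axioms] reachable_awalk assms by metis
  also have "\<dots> \<le> awalk_cost (\<lambda>_. 1) p"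
    using min_cost_le_walk_cost[OF assms] .
  finally show ?thesis by (simp add: cost)
qed

lemma (in pair_wf_digraph) graph_dist_awalk:
  assumes "u \<rightarrow>\<^sup>*\<^bsub>with_proj G\<^esub> v"
  obtains p where "awalk u p v" and "length p = graph_dist G u v"
proof -
  have "\<exists>k p. apath u p v \<and> length p = k"
    using assms by (simp add: reachable_apath)
  then have "\<exists>p. apath u p v \<and> length p = graph_dist G u v"
    unfolding graph_dist_def by (rule LeastI_ex)
  then show ?thesis using that awalkI_apath by blast
qed

lemma (in pair_wf_digraph) graph_dist_le_1D:
  assumes "u \<rightarrow>\<^sup>*\<^bsub>with_proj G\<^esub> v" and "graph_dist G u v \<le> 1"
  shows "u = v \<or> (u, v) \<in> parcs G"
proof -
  obtain p where p: "awalk u p v" "length p = graph_dist G u v"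
    using assms(1) by (rule graph_dist_awalk)
  then have "p = [] \<or> (\<exists>e. p = [e])"
    using assms(2) by (cases p) (auto simp: le_Suc_eq simp flip: p(2))
  then show ?thesis
    using p(1) by (auto simp: awalk_Cons_iff awalk_Nil_iff)
qed

lemma (in pair_wf_digraph) graph_dist_le_Suc:
  assumes "(u, v) \<in> parcs G" and "v \<rightarrow>\<^sup>*\<^bsub>with_proj G\<^esub> w"
  shows "graph_dist G u w \<le> Suc (graph_dist G v w)"
proof -
  obtain p where p: "awalk v p w" "length p = graph_dist G v w"
    using assms(2) by (rule graph_dist_awalk)
  then have "awalk u ((u, v) # p) w"
    using assms(1) by (simp add: awalk_Cons_iff)
  from graph_dist_le_awalk[OF this] p(2) show ?thesis by simp
qed

lemma two_le_card:
  assumes "finite A" and "a \<in> A" and "b \<in> A" and "a \<noteq> b"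
  shows "2 \<le> card A"
  using card_mono[of A "{a, b}"] assms by simp

section \<open>Distances in a corona product\<close>

locale corona_family =
  fixes G :: "'a pair_pre_digraph" and H :: "'a \<Rightarrow> 'b pair_pre_digraph"
  assumes graph_G: "pair_graph G"
    and connected_G: "Digraph_Component.connected G"
    and order_G: "2 \<le> card (pverts G)"
    and graph_H: "v \<in> pverts G \<Longrightarrow> pair_graph (H v)"
    and order_H: "v \<in> pverts G \<Longrightarrow> 2 \<le> card (pverts (H v))"
begin

abbreviation C :: "('a + 'a \<times> 'b) pair_pre_digraph" where
  "C \<equiv> corona G H"

abbreviation d :: "'a + 'a \<times> 'b \<Rightarrow> 'a + 'a \<times> 'b \<Rightarrow> nat" where
  "d \<equiv> graph_dist C"

definition fibre :: "'a \<Rightarrow> ('a + 'a \<times> 'b) set" where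
  "fibre v = (\<lambda>x. Inr (v, x)) ` pverts (H v)"

sublocale C: pair_graph C
  using pair_graph_corona[OF graph_G graph_H] .

lemma connected_C: "Digraph_Component.connected C"
  using connected_corona[OF graph_G connected_G graph_H] .

lemma reach_C:
  assumes "a \<in> pverts C" and "b \<in> pverts C"
  shows "a \<rightarrow>\<^sup>*\<^bsub>with_proj C\<^esub> b"
  using connected_reachable[OF C.pair_graph_axioms connected_C assms] .

lemma Inl_in_C [simp]: "Inl v \<in> pverts C \<longleftrightarrow> v \<in> pverts G"
  by (auto simp: corona_def)

lemma Inr_in_C [simp]: "Inr (v, x) \<in> pverts C \<longleftrightarrow> v \<in> pverts G \<and> x \<in> pverts (H v)"
  by (auto simp: corona_def)

lemma fibre_subset: "v \<in> pverts G \<Longrightarrow> fibre v \<subseteq> pverts C"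
  by (auto simp: fibre_def)

lemma arcs_C:
  "(Inl u, Inl v) \<in> parcs C \<longleftrightarrow> (u, v) \<in> parcs G"
  "(Inr (u, x), Inl v) \<in> parcs C \<longleftrightarrow> u = v \<and> v \<in> pverts G \<and> x \<in> pverts (H v)"
  "(Inl u, Inr (v, y)) \<in> parcs C \<longleftrightarrow> u = v \<and> v \<in> pverts G \<and> y \<in> pverts (H v)"
  "(Inr (u, x), Inr (v, y)) \<in> parcs C \<longleftrightarrow> u = v \<and> v \<in> pverts G \<and> (x, y) \<in> parcs (H v)"
  by (auto simp: corona_def)

lemma dist_eq_0_iff:
  assumes "a \<in> pverts C" and "b \<in> pverts C"
  shows "d a b = 0 \<longleftrightarrow> a = b"
  using graph_dist_self[OF C.pair_wf_digraph_axioms]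
    graph_dist_neq_0[OF C.pair_graph_axioms connected_C] assms by metis

lemma dist_adj:
  assumes "(a, b) \<in> parcs C"
  shows "d a b = 1"
proof -
  have ab: "a \<in> pverts C" "b \<in> pverts C" "a \<noteq> b"
    using assms C.in_arcsD1 C.in_arcsD2 C.pair_no_loops by fastforce+
  have "d a b \<le> Suc (d b b)"
    using C.graph_dist_le_Suc[OF assms reach_C] ab by blast
  then show ?thesis using ab dist_eq_0_iff[of b b] dist_eq_0_iff[of a b] by simp
qed

lemma dist_ge_2:
  assumes "a \<in> pverts C" and "b \<in> pverts C" and "a \<noteq> b" and "(a, b) \<notin> parcs C"
  shows "2 \<le> d a b"
  using C.graph_dist_le_1D[OF reach_C[OF assms(1,2)]] assms(3,4) by linarith

text \<open>The detour through the root bounds all distances within a fibre by 2.\<close>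

lemma dist_within_fibre:
  assumes "v \<in> pverts G" and "x \<in> pverts (H v)" and "y \<in> pverts (H v)"
  shows "d (Inr (v, x)) (Inr (v, y)) =
    (if x = y then 0 else if (x, y) \<in> parcs (H v) then 1 else 2)"
proof -
  have "d (Inr (v, x)) (Inr (v, y)) \<le> Suc (d (Inl v) (Inr (v, y)))"
    using assms by (intro C.graph_dist_le_Suc reach_C) (simp_all add: arcs_C)
  also have "d (Inl v) (Inr (v, y)) = 1"
    using assms by (intro dist_adj) (simp add: arcs_C)
  finally have "d (Inr (v, x)) (Inr (v, y)) \<le> 2" by simp
  then show ?thesis
    using assms dist_ge_2[of "Inr (v, x)" "Inr (v, y)"] dist_adj[of "Inr (v, x)" "Inr (v, y)"]
      dist_eq_0_iff[of "Inr (v, x)" "Inr (v, y)"]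
    by (auto simp: arcs_C)
qed

text \<open>
  Follow the walk up to its first arc out of the fibre. That arc can only lead to the root, and what
  remains is a walk from the root to \<open>z\<close>.
\<close>

lemma length_awalk_leaving_fibre:
  assumes "C.awalk a p z" and "a \<in> fibre v" and "z \<notin> fibre v"
  shows "Suc (d (Inl v) z) \<le> length p"
  using assms
proof (induction p arbitrary: a)
  case Nil
  then show ?case by (simp add: C.awalk_Nil_iff)
next
  case (Cons e p)
  then obtain b where b: "(a, b) \<in> parcs C" "C.awalk b p z"
    by (cases e) (auto simp: C.awalk_Cons_iff)
  obtain x where x: "a = Inr (v, x)"
    using Cons.prems(2) by (auto simp: fibre_def)
  have "b \<in> pverts C" using b(1) C.in_arcsD2 by fastforce
  then consider "b = Inl v" | "b \<in> fibre v"
    using b(1) x by (cases b) (auto simp: arcs_C fibre_def)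
  then show ?case
  proof cases
    case 1
    then show ?thesis using C.graph_dist_le_awalk[OF b(2)] by simp
  next
    case 2
    then show ?thesis using Cons.IH[OF b(2)] Cons.prems(3) by simp
  qed
qed

lemma dist_leaving_fibre:
  assumes "v \<in> pverts G" and "x \<in> pverts (H v)" and "z \<in> pverts C" and "z \<notin> fibre v"
  shows "d (Inr (v, x)) z = Suc (d (Inl v) z)"
proof (rule antisym)
  show "d (Inr (v, x)) z \<le> Suc (d (Inl v) z)"
    using assms by (intro C.graph_dist_le_Suc reach_C) (simp_all add: arcs_C)
  obtain p where p: "C.awalk (Inr (v, x)) p z" "length p = d (Inr (v, x)) z"
    using C.graph_dist_awalk[OF reach_C] assms(1-3) Inr_in_C by blast
  have "Inr (v, x) \<in> fibre v" using assms(2) by (simp add: fibre_def)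
  from length_awalk_leaving_fibre[OF p(1) this assms(4)] p(2)
  show "Suc (d (Inl v) z) \<le> d (Inr (v, x)) z" by simp
qed

lemma dist_into_fibre:
  assumes "u \<in> pverts G" and "v \<in> pverts G" and "z \<in> fibre u"
  shows "d (Inl v) z = 1 \<longleftrightarrow> u = v" and "u \<noteq> v \<Longrightarrow> 2 \<le> d (Inl v) z"
proof -
  obtain y where y: "z = Inr (u, y)" "y \<in> pverts (H u)"
    using assms(3) by (auto simp: fibre_def)
  show *: "u \<noteq> v \<Longrightarrow> 2 \<le> d (Inl v) z"
    using y assms by (intro dist_ge_2) (auto simp: arcs_C)
  have "u = v \<Longrightarrow> d (Inl v) z = 1"
    using y assms by (intro dist_adj) (auto simp: arcs_C)
  with * show "d (Inl v) z = 1 \<longleftrightarrow> u = v" by force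
qed

section \<open>2-metric generators of a corona product\<close>

text \<open>
  The hypothesis applied to any two vertices of a fibre shows that \<open>S\<close> has two elements in that
  fibre. It then suffices to find, for two vertices not in a common fibre, a fibre all of whose
  vertices distinguish them: for a root and a vertex of its own fibre, any other fibre; for two
  roots or two vertices from different fibres, the fibre belonging to either of them; for a root
  and a vertex of another fibre, the fibre over the root.
\<close>

lemma two_metric_generator_if_fibrewise:
  assumes "S \<subseteq> pverts C"
    and local: "\<And>v x y. v \<in> pverts G \<Longrightarrow> x \<in> pverts (H v) \<Longrightarrow> y \<in> pverts (H v) \<Longrightarrow> x \<noteq> y \<Longrightarrow>
      2 \<le> card {w \<in> S \<inter> fibre v. d (Inr (v, x)) w \<noteq> d (Inr (v, y)) w}"
  shows "two_metric_generator C S"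
proof -
  let ?D = "\<lambda>a b. {w \<in> S. d a w \<noteq> d b w}"
  have finS: "finite S" using assms(1) C.pair_finite_verts finite_subset by blast
  have mono: "2 \<le> card (?D a b)" if "A \<subseteq> ?D a b" "2 \<le> card A" for a b A
    using that card_mono[of "?D a b" A] finS by simp
  have big: "2 \<le> card (S \<inter> fibre v)" if v: "v \<in> pverts G" for v
  proof -
    obtain x y where "x \<in> pverts (H v)" "y \<in> pverts (H v)" "x \<noteq> y"
      using order_H[OF v] by (auto simp: numeral_2_eq_2 card_le_Suc_iff)
    from local[OF v this] show ?thesis
      using card_mono[of "S \<inter> fibre v"] finS
      by (metis (no_types, lifting) finite_Int le_trans mem_Collect_eq subsetI)
  qed
  have whole: "2 \<le> card (?D a b)"
    if "v \<in> pverts G" "\<And>z. z \<in> pverts C \<Longrightarrow> z \<in> fibre v \<Longrightarrow> d a z \<noteq> d b z" for a b v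
    using mono[OF _ big[OF that(1)], of a b] that(2) assms(1) by blast
  have swap: "?D a b = ?D b a" for a b by auto
  have across: "2 \<le> d (Inl v) z \<and>
      (\<forall>y\<in>pverts (H v). d (Inr (v, y)) z = Suc (d (Inl v) z))"
    if "u \<in> pverts G" "v \<in> pverts G" "u \<noteq> v" "z \<in> fibre u" for u v z
  proof -
    have "z \<in> pverts C" "z \<notin> fibre v"
      using that fibre_subset[OF that(1)] by (auto simp: fibre_def)
    then show ?thesis
      using that dist_into_fibre(2) dist_leaving_fibre by auto
  qed
  have Inl_Inl: "2 \<le> card (?D (Inl u) (Inl v))"
    if "u \<in> pverts G" "v \<in> pverts G" "u \<noteq> v" for u v
    by (rule whole[OF that(1)]) (use that dist_into_fibre[of u] in fastforce)
  have Inl_Inr: "2 \<le> card (?D (Inl u) (Inr (v, y)))"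
    if "u \<in> pverts G" "v \<in> pverts G" "y \<in> pverts (H v)" for u v y
  proof (cases "u = v")
    case True
    \<comment> \<open>Any fibre over a vertex \<open>w\<close> other than \<open>v\<close> works, as \<open>y\<close> is one step further from it than
      its root \<open>v\<close>. Such a \<open>w\<close> exists because \<open>G\<close> is not trivial.\<close>
    obtain w where "w \<in> pverts G" "w \<noteq> v"
    proof -
      have "\<not> pverts G \<subseteq> {v}"
        using order_G card_mono[of "{v}" "pverts G"] by auto
      then show ?thesis using that by blast
    qed
    then show ?thesis
      by (intro whole[of w]) (use that True across[of w v] in auto)
  next
    case False
    show ?thesis
    proof (rule whole[OF that(1)])
      fix z assume z: "z \<in> fibre u"
      have "d (Inl u) z = 1" using dist_into_fibre(1) that(1) z by blast
      then show "d (Inl u) z \<noteq> d (Inr (v, y)) z"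
        using across[OF that(1,2) False z] that(3) by auto
    qed
  qed
  have Inr_Inr: "2 \<le> card (?D (Inr (u, x)) (Inr (v, y)))"
    if "u \<in> pverts G" "v \<in> pverts G" "x \<in> pverts (H u)" "y \<in> pverts (H v)"
      "(u, x) \<noteq> (v, y)" for u v x y
  proof (cases "u = v")
    case True
    show ?thesis
      by (rule mono[OF _ local[of v x y]]) (use that True in auto)
  next
    case False
    \<comment> \<open>The fibre over \<open>u\<close> is at distance at most 2 from \<open>x\<close>, but at least 3 from \<open>y\<close>.\<close>
    show ?thesis
    proof (rule whole[OF that(1)])
      fix z assume z: "z \<in> fibre u"
      then have "d (Inr (u, x)) z \<le> 2"
        using that by (auto simp: fibre_def dist_within_fibre)
      then show "d (Inr (u, x)) z \<noteq> d (Inr (v, y)) z"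
        using across[OF that(1,2) False z] that(4) by auto
    qed
  qed
  show ?thesis
    unfolding two_metric_generator_def
  proof (intro conjI ballI impI)
    fix a b assume ab: "a \<in> pverts C" "b \<in> pverts C" "a \<noteq> b"
    show "2 \<le> card (?D a b)"
    proof (cases a; cases b)
      fix u v assume "a = Inl u" "b = Inl v"
      then show ?thesis using ab Inl_Inl by simp
    next
      fix u q assume "a = Inl u" "b = Inr q"
      then show ?thesis using ab Inl_Inr by (cases q) simp
    next
      fix p v assume "a = Inr p" "b = Inl v"
      then show ?thesis using ab Inl_Inr swap[of a b] by (cases p) simp
    next
      fix p q assume "a = Inr p" "b = Inr q"
      then show ?thesis using ab Inr_Inr by (cases p; cases q) simp
    qed
  qed (fact assms(1))
qed

definition copies :: "('a + 'a \<times> 'b) set" where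
  "copies = Inr ` (SIGMA v:pverts G. pverts (H v))"

lemma finite_H: "v \<in> pverts G \<Longrightarrow> finite (pverts (H v))"
  using order_H by (metis card.infinite not_numeral_le_zero)

lemma card_copies: "card copies = (\<Sum>v\<in>pverts G. card (pverts (H v)))"
proof -
  interpret G: pair_graph G by (fact graph_G)
  show ?thesis
    by (simp add: copies_def card_image finite_H)
qed

text \<open>
  From a third vertex of their fibre twins are equally far because they have the same neighbours
  there, and from outside the fibre because all vertices of a fibre are. Without \<open>x\<close>, only \<open>y\<close> would
  be left to distinguish \<open>x\<close> from \<open>y\<close>.
\<close>

lemma twins_in_generator:
  assumes S: "two_metric_generator C S" and v: "v \<in> pverts G" and tw: "twins (H v) x y"
  shows "Inr (v, x) \<in> S"
proof (rule ccontr)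
  interpret H: pair_graph "H v" using graph_H[OF v] .
  assume not_in: "Inr (v, x) \<notin> S"
  have xy: "x \<in> pverts (H v)" "y \<in> pverts (H v)" "x \<noteq> y"
    using tw by (auto simp: twins_def)
  have adj: "(x, w) \<in> parcs (H v) \<longleftrightarrow> (y, w) \<in> parcs (H v)" if "w \<noteq> x" "w \<noteq> y" for w
    using tw that by (auto simp: twins_def closed_nbhd_def open_nbhd_def)
  have "z = Inr (v, y)"
    if z: "z \<in> S" "d (Inr (v, x)) z \<noteq> d (Inr (v, y)) z" for z
  proof -
    have zC: "z \<in> pverts C" using S z(1) by (auto simp: two_metric_generator_def)
    have "z \<in> fibre v"
      using dist_leaving_fibre[OF v _ zC] xy(1,2) z(2) by metis
    then obtain w where w: "z = Inr (v, w)" "w \<in> pverts (H v)"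
      by (auto simp: fibre_def)
    have "w \<noteq> x" using not_in z(1) w(1) by blast
    then have "w = y"
      using z(2) adj[of w] w v xy by (auto simp: dist_within_fibre split: if_splits)
    with w show ?thesis by simp
  qed
  then have "{z \<in> S. d (Inr (v, x)) z \<noteq> d (Inr (v, y)) z} \<subseteq> {Inr (v, y)}"
    by blast
  from card_mono[OF _ this]
  have "card {z \<in> S. d (Inr (v, x)) z \<noteq> d (Inr (v, y)) z} \<le> 1" by simp
  moreover have "2 \<le> card {z \<in> S. d (Inr (v, x)) z \<noteq> d (Inr (v, y)) z}"
    using S xy v by (simp add: two_metric_generator_def)
  ultimately show False by simp
qed

text \<open>
  Open neighbourhoods that agree apart from \<open>x\<close> and \<open>y\<close> make \<open>x\<close> and \<open>y\<close> true twins if they are adjacent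
  and false twins otherwise. So non-twins have a third vertex adjacent to exactly one of them.
\<close>

lemma nontwin_distinguished:
  assumes v: "v \<in> pverts G" and "x \<in> pverts (H v)" and "\<not> is_twin (H v) x"
    and "y \<in> pverts (H v)" and "x \<noteq> y"
  obtains w where "w \<in> pverts (H v)" and "w \<noteq> x" and "w \<noteq> y"
    and "d (Inr (v, x)) (Inr (v, w)) \<noteq> d (Inr (v, y)) (Inr (v, w))"
proof -
  interpret H: pair_graph "H v" using graph_H[OF v] .
  have sym: "(x, y) \<in> parcs (H v) \<longleftrightarrow> (y, x) \<in> parcs (H v)"
    using H.arcs_symmetric by blast
  have irrefl: "(z, z) \<notin> parcs (H v)" for z
    using H.pair_no_loops by fastforce
  have "\<not> twins (H v) x y" using assms(3) by (auto simp: is_twin_def)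
  then have neq: "open_nbhd (H v) x \<noteq> open_nbhd (H v) y" "closed_nbhd (H v) x \<noteq> closed_nbhd (H v) y"
    using assms by (auto simp: twins_def)
  have "\<exists>w. w \<noteq> x \<and> w \<noteq> y \<and> ((x, w) \<in> parcs (H v) \<longleftrightarrow> (y, w) \<notin> parcs (H v))"
  proof (cases "(x, y) \<in> parcs (H v)")
    case True
    obtain w where w: "w \<in> closed_nbhd (H v) x \<longleftrightarrow> w \<notin> closed_nbhd (H v) y"
      using neq(2) by blast
    have "x \<in> closed_nbhd (H v) y" "y \<in> closed_nbhd (H v) x"
      using True sym by (auto simp: closed_nbhd_def open_nbhd_def)
    with w have "w \<noteq> x" "w \<noteq> y" by (auto simp: closed_nbhd_def)
    with w show ?thesis by (auto simp: closed_nbhd_def open_nbhd_def)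
  next
    case False
    obtain w where w: "(x, w) \<in> parcs (H v) \<longleftrightarrow> (y, w) \<notin> parcs (H v)"
      using neq(1) unfolding open_nbhd_def by blast
    with False sym irrefl have "w \<noteq> x" "w \<noteq> y" by blast+
    with w show ?thesis by blast
  qed
  then obtain w where w: "w \<noteq> x" "w \<noteq> y" "(x, w) \<in> parcs (H v) \<longleftrightarrow> (y, w) \<notin> parcs (H v)"
    by blast
  then have "w \<in> pverts (H v)" using H.in_arcsD2 by blast
  with w show ?thesis
    using assms by (intro that[of w]) (auto simp: dist_within_fibre)
qed

lemma generator_copies: "two_metric_generator C copies"
proof (rule two_metric_generator_if_fibrewise)
  show "copies \<subseteq> pverts C" by (auto simp: copies_def)
  fix v x y assume *: "v \<in> pverts G" "x \<in> pverts (H v)" "y \<in> pverts (H v)" "x \<noteq> y"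
  show "2 \<le> card {w \<in> copies \<inter> fibre v. d (Inr (v, x)) w \<noteq> d (Inr (v, y)) w}"
    by (rule two_le_card[of _ "Inr (v, x)" "Inr (v, y)"])
      (use * finite_H in \<open>auto simp: copies_def fibre_def dist_within_fibre\<close>)
qed

text \<open>
  Pairs of a fibre that avoid \<open>x\<close> are still distinguished by their own two members; for the pairs
  containing \<open>x\<close>, the third vertex from \<open>nontwin_distinguished\<close> replaces \<open>x\<close>.
\<close>

lemma generator_copies_minus_nontwin:
  assumes v: "v \<in> pverts G" and x: "x \<in> pverts (H v)" and nt: "\<not> is_twin (H v) x"
  shows "two_metric_generator C (copies - {Inr (v, x)})" (is "two_metric_generator C ?S")
proof (rule two_metric_generator_if_fibrewise)
  show "?S \<subseteq> pverts C" by (auto simp: copies_def)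
  have one: "2 \<le> card {w \<in> ?S \<inter> fibre v. d (Inr (v, x)) w \<noteq> d (Inr (v, y)) w}"
    if y: "y \<in> pverts (H v)" "x \<noteq> y" for y
  proof -
    obtain w where w: "w \<in> pverts (H v)" "w \<noteq> x" "w \<noteq> y"
      "d (Inr (v, x)) (Inr (v, w)) \<noteq> d (Inr (v, y)) (Inr (v, w))"
      using nontwin_distinguished[OF v x nt y] .
    show ?thesis
      by (rule two_le_card[of _ "Inr (v, y)" "Inr (v, w)"])
        (use v x y w finite_H[OF v] in \<open>auto simp: copies_def fibre_def dist_within_fibre\<close>)
  qed
  fix u a b assume *: "u \<in> pverts G" "a \<in> pverts (H u)" "b \<in> pverts (H u)" "a \<noteq> b"
  consider "u = v" "a = x" | "u = v" "b = x" | "(u, a) \<noteq> (v, x)" "(u, b) \<noteq> (v, x)"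
    by blast
  then show "2 \<le> card {w \<in> ?S \<inter> fibre u. d (Inr (u, a)) w \<noteq> d (Inr (u, b)) w}"
  proof cases
    case 1
    then show ?thesis using one[of b] * by simp
  next
    case 2
    then show ?thesis using one[of a] * by (simp add: eq_commute)
  next
    case 3
    show ?thesis
      by (rule two_le_card[of _ "Inr (u, a)" "Inr (u, b)"])
        (use * 3 finite_H in \<open>auto simp: copies_def fibre_def dist_within_fibre\<close>)
  qed
qed

lemma dim_eq_card_copies_iff:
  "two_metric_dim C = card copies \<longleftrightarrow> (\<forall>v\<in>pverts G. \<forall>x\<in>pverts (H v). is_twin (H v) x)"
proof
  assume dim: "two_metric_dim C = card copies"
  show "\<forall>v\<in>pverts G. \<forall>x\<in>pverts (H v). is_twin (H v) x"
  proof (intro ballI, rule ccontr)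
    fix v x assume *: "v \<in> pverts G" "x \<in> pverts (H v)" "\<not> is_twin (H v) x"
    have "two_metric_dim C \<le> card (copies - {Inr (v, x)})"
      unfolding two_metric_dim_def
      using generator_copies_minus_nontwin[OF *] by (intro Least_le) blast
    also have "\<dots> < card copies"
    proof (rule card_Diff1_less)
      show "finite copies"
        using generator_copies C.pair_finite_verts finite_subset
        unfolding two_metric_generator_def by blast
    qed (use * in \<open>auto simp: copies_def\<close>)
    finally show False using dim by simp
  qed
next
  assume tw: "\<forall>v\<in>pverts G. \<forall>x\<in>pverts (H v). is_twin (H v) x"
  show "two_metric_dim C = card copies"
    unfolding two_metric_dim_def
  proof (rule Least_equality)
    fix k assume "\<exists>S. two_metric_generator C S \<and> card S = k"
    then obtain S where S: "two_metric_generator C S" "card S = k" by blast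
    have "finite S"
      using S(1) C.pair_finite_verts finite_subset unfolding two_metric_generator_def by blast
    moreover have "copies \<subseteq> S"
      using tw twins_in_generator[OF S(1)] unfolding copies_def is_twin_def by blast
    ultimately show "card copies \<le> k" using S(2) card_mono by blast
  qed (use generator_copies in blast)
qed

end

theorem theorem28:
  fixes G :: "'a pair_pre_digraph" and H :: "'a \<Rightarrow> 'b pair_pre_digraph"
  assumes "pair_graph G" and "Digraph_Component.connected G" and "card (pverts G) \<ge> 2"
    and "\<And>v. v \<in> pverts G \<Longrightarrow> pair_graph (H v)"
    and "\<And>v. v \<in> pverts G \<Longrightarrow> Digraph_Component.connected (H v)"
    and "\<And>v. v \<in> pverts G \<Longrightarrow> card (pverts (H v)) \<ge> 2"
  shows "(\<forall>v\<in>pverts G. \<forall>x\<in>pverts (H v). is_twin (H v) x) \<longleftrightarrow>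
    two_metric_dim (corona G H) = (\<Sum>v\<in>pverts G. card (pverts (H v)))"
proof -
  interpret corona_family G H
    using assms by (intro corona_family.intro)
  show ?thesis
    using dim_eq_card_copies_iff by (simp add: card_copies)
qed

end
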